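(* Let $n\ge 1$ and let $D$ be a Dyck path of semilength $n$. The number of frustrated parking functions $(a_1,\dots,a_n)$ of length $n$ such that $\varphi(a_1,\dots,a_n)=D$ is equal to the number of height labeled Dyck paths with underlying Dyck path $D$.
   Context: Let $n\ge 1$ and $[n]=\{1,2,\dots,n\}$. There are $n$ cars and $n$ parking spots numbered $1,\dots,n$, all initially empty. Given a preference sequence $(a_1,\dots,a_n)\in[n]^n$, cars $1,2,\dots,n$ enter in this order. If spot $a_i$ is unoccupied when car $i$ enters, car $i$ parks in spot $a_i$. Otherwise car $i$ parks in the largest-numbered unoccupied spot greater than $a_i$, if such a spot exists; if none exists, car $i$ cannot park. The sequence $(a_1,\dots,a_n)$ is a frustrated parking function of length $n$ if all $n$ cars can park under this rule; $\mathrm{FPF}_n$ is the set of these. For a frustrated parking function, car $j$ is lucky if it parks in its preferred spot $a_j$, and unlucky otherwise. A Dyck path of semilength $n$ is a word with $n$ letters $U$ (up step $(1,1)$) and $n$ letters $D$ (down step $(1,-1)$), started at the origin, never going below the $x$-axis; $\mathrm{Dyck}_n$ is the set of these. The height of a down step is the $y$-coordinate of the point where that down step begins. A height labeled Dyck path is a Dyck path together with a labeling of its down steps by positive integers such that each label is at most the height of its down step. The map $\varphi:\mathrm{FPF}_n\to\mathrm{Dyck}_n$ is defined as follows. Start with the empty path and process the cars in the order $1,\dots,n$. If the current car is lucky, append one up step. If the current car is unlucky and parks in spot $t$, let $s$ be the spot in which the previous unlucky car parked (or $s=n+1$ if the current car is the first unlucky car), and append $s-t$ down steps followed by one up step. After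 all cars have parked, append down steps until the path returns to the $x$-axis, so that it has $n$ down steps. The result is a Dyck path of semilength $n$. *)

theory Defs
  imports Main "HOL-Library.FuncSet"
begin

text \<open>
  A preference sequence \<open>(a\<^sub>1, \<dots>, a\<^sub>n)\<close> is a list of length \<open>n\<close>, so car \<open>i\<close> is the list
  entry at index \<open>i - 1\<close>; parking spots keep their names \<open>1, \<dots>, n\<close>.
\<close>

definition free_above :: "nat \<Rightarrow> nat set \<Rightarrow> nat \<Rightarrow> nat set" where
  "free_above n occ a = {t \<in> {a<..n}. t \<notin> occ}"

definition choose_spot :: "nat \<Rightarrow> nat set \<Rightarrow> nat \<Rightarrow> nat option" where
  "choose_spot n occ a =
     (if a \<notin> occ then Some a
      else if free_above n occ a \<noteq> {} then Some (Max (free_above n occ a))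
      else None)"

text \<open>
  \<open>park n occ as\<close> lists the outcomes of the cars \<open>as\<close>, entering in order when the spots in
  \<open>occ\<close> are already taken; \<open>None\<close> stands for a car that cannot park.
\<close>

fun park :: "nat \<Rightarrow> nat set \<Rightarrow> nat list \<Rightarrow> nat option list" where
  "park n occ [] = []"
| "park n occ (a # as) =
     (case choose_spot n occ a of
        None \<Rightarrow> None # park n occ as
      | Some t \<Rightarrow> Some t # park n (insert t occ) as)"

definition FPF :: "nat \<Rightarrow> nat list set" where
  "FPF n = {as. length as = n \<and> set as \<subseteq> {1..n} \<and> None \<notin> set (park n {} as)}"

datatype step = Up | Down

definition height :: "step list \<Rightarrow> int" where
  "height w = int (count_list w Up) - int (count_list w Down)"

definition dyck_paths :: "nat \<Rightarrow> step list set" where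
  "dyck_paths n = {w. count_list w Up = n \<and> count_list w Down = n \<and>
                      (\<forall>k \<le> length w. height (take k w) \<ge> 0)}"

text \<open>
  Steps are referred to by their index in the word. The step with index \<open>k\<close> begins at the
  endpoint of the prefix of length \<open>k\<close>.
\<close>

definition down_steps :: "step list \<Rightarrow> nat set" where
  "down_steps w = {k. k < length w \<and> w ! k = Down}"

definition down_height :: "step list \<Rightarrow> nat \<Rightarrow> int" where
  "down_height w k = height (take k w)"

text \<open>
  Labelings are extensional functions (\<open>undefined\<close> off the down steps), so that each labeling
  of the down steps is represented exactly once.
\<close>

definition height_labeled_dyck_paths :: "nat \<Rightarrow> (step list \<times> (nat \<Rightarrow> nat)) set" where
  "height_labeled_dyck_paths n =
     {(w, l). w \<in> dyck_paths n \<and>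
              l \<in> (\<Pi>\<^sub>E k \<in> down_steps w. {m. 1 \<le> m \<and> int m \<le> down_height w k})}"

text \<open>
  The argument of \<open>phi_steps s\<close> is a list of pairs (preferred spot, actual spot); the car is
  lucky iff the two agree. The parameter \<open>s\<close> is the spot of the previous unlucky car, initially
  \<open>n + 1\<close>. For a frustrated parking function the unlucky cars park in decreasing order of
  spots, so \<open>s - t\<close> is never truncated.
\<close>

fun phi_steps :: "nat \<Rightarrow> (nat \<times> nat) list \<Rightarrow> step list" where
  "phi_steps s [] = []"
| "phi_steps s ((a, t) # cars) =
     (if t = a then Up # phi_steps s cars
      else replicate (s - t) Down @ Up # phi_steps t cars)"

definition phi :: "nat \<Rightarrow> nat list \<Rightarrow> step list" where
  "phi n as =
     (let w = phi_steps (n + 1) (zip as (map the (park n {} as)))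
      in w @ replicate (nat (height w)) Down)"

end

theory Submission
  imports Defs
begin

text \<open>
  An unlucky car takes the largest free spot that exceeds its preference, so afterwards no larger
  spot is free. Hence the unlucky cars park further and further to the left, and an unlucky car
  simply takes the largest free spot \<open>t\<close>, its preference being any occupied spot below \<open>t\<close>.
  Call the spot of the latest unlucky car (initially \<open>n + 1\<close>) the front \<open>s\<close>: all spots from \<open>s\<close> to
  \<open>n\<close> are taken. A prefix of the path that corresponds to a number of cars has one up step per car
  and \<open>n + 1 - s\<close> down steps, so its height is the number of taken spots below the front.

  The fiber of \<open>\<phi>\<close> is counted by taking away the last car. A path up to an up step determines
  whether that car is lucky and where the front is, and an unlucky car sits at the front. Suppose
  that the set \<open>O\<close> of taken spots after this car is prescribed. If the car is lucky, its spot can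
  be any element of \<open>O\<close> below the front. If it is unlucky, its spot is known and its preference can
  be any element of \<open>O\<close> below the front. Either way the number of choices is the height reached by
  the up step, and it does not depend on \<open>O\<close> or on the choices made before. So the fiber
  has as many elements as the product, over all up steps, of the height reached
  (\<open>card_fiber\<close>).

  A Dyck path crosses each level as often upwards as downwards, so this product equals the
  product of the heights of the down steps (\<open>down_weight_path_of\<close>), which is the number of height
  labelings.
\<close>

section \<open>Words as sequences of descents\<close>

text \<open>
  A word is recorded by the numbers of down steps immediately before its up steps, apart from a
  final run of down steps. In the path of a frustrated parking function each car contributes one
  such number, \<open>0\<close> for a lucky car.
\<close>

definition path_of :: "nat list \<Rightarrow> step list" where
  "path_of ks = concat (map (\<lambda>k. replicate k Down @ [Up]) ks)"

lemma path_of_simps [simp]: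
  "path_of [] = []"
  "path_of (k # ks) = replicate k Down @ Up # path_of ks"
  "path_of (ks @ ks') = path_of ks @ path_of ks'"
  by (simp_all add: path_of_def)

lemma replicate_Down_Up_eq_iff:
  "replicate k Down @ Up # u = replicate j Down @ Up # v \<longleftrightarrow> k = j \<and> u = v"
proof (induction k arbitrary: j)
  case 0
  show ?case by (cases j) auto
next
  case (Suc k)
  then show ?case by (cases j) auto
qed

lemma replicate_Down_neq_Up: "replicate m Down \<noteq> replicate k Down @ Up # u"
proof
  assume "replicate m Down = replicate k Down @ Up # u"
  then have "Up \<in> set (replicate m Down)" by simp
  then show False by simp
qed

lemma path_of_append_inject:
  "path_of ks @ replicate m Down = path_of js @ replicate l Down \<Longrightarrow> ks = js"
proof (induction ks arbitrary: js)
  case Nil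
  then show ?case by (cases js) (auto simp: replicate_Down_neq_Up)
next
  case (Cons k ks)
  then show ?case
    using replicate_Down_neq_Up[of l k "path_of ks @ replicate m Down"]
    by (cases js) (auto simp: replicate_Down_Up_eq_iff)
qed

lemma ex_path_of: "\<exists>ks m. w = path_of ks @ replicate m Down"
proof (induction w)
  case Nil
  have "[] = path_of [] @ replicate 0 Down" by simp
  then show ?case by blast
next
  case (Cons x w)
  then obtain ks m where w: "w = path_of ks @ replicate m Down" by blast
  show ?case
  proof (cases x)
    case Up
    then have "x # w = path_of (0 # ks) @ replicate m Down" by (simp add: w)
    then show ?thesis by blast
  next
    case Down
    show ?thesis
    proof (cases ks)
      case Nil
      then have "x # w = path_of [] @ replicate (Suc m) Down" by (simp add: w Down)
      then show ?thesis by blast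
    next
      case (Cons k js)
      then have "x # w = path_of (Suc k # js) @ replicate m Down" by (simp add: w Down)
      then show ?thesis by blast
    qed
  qed
qed

lemma count_list_replicate_Down [simp]:
  "count_list (replicate m Down) Up = 0" "count_list (replicate m Down) Down = m"
  by (induction m) auto

lemma count_list_path_of [simp]:
  "count_list (path_of ks) Up = length ks"
  "count_list (path_of ks) Down = sum_list ks"
  by (induction ks) auto

lemma height_Nil [simp]: "height [] = 0"
  by (simp add: height_def)

lemma height_append [simp]: "height (u @ v) = height u + height v"
  by (simp add: height_def)

lemma height_path_of [simp]: "height (path_of ks) = int (length ks) - int (sum_list ks)"
  by (simp add: height_def)

lemma height_replicate_Down [simp]: "height (replicate m Down) = - int m"
  by (simp add: height_def)

section \<open>Product of the heights of the down steps\<close>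

definition down_weight :: "step list \<Rightarrow> nat" where
  "down_weight w = (\<Prod>k \<in> down_steps w. nat (down_height w k))"

lemma finite_down_steps [simp]: "finite (down_steps w)"
  by (simp add: down_steps_def)

lemma prod_down_steps_snoc:
  "(\<Prod>k \<in> down_steps w. nat (down_height (w @ [x]) k)) = down_weight w"
  unfolding down_weight_def
  by (rule prod.cong) (auto simp: down_steps_def down_height_def)

lemma down_weight_snoc_Up [simp]: "down_weight (w @ [Up]) = down_weight w"
proof -
  have "down_steps (w @ [Up]) = down_steps w"
    by (auto simp: down_steps_def nth_append less_Suc_eq)
  then show ?thesis by (simp add: prod_down_steps_snoc down_weight_def[of "w @ [Up]"])
qed

lemma down_weight_snoc_Down [simp]: "down_weight (w @ [Down]) = nat (height w) * down_weight w"
proof -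
  have "down_steps (w @ [Down]) = insert (length w) (down_steps w)"
    by (auto simp: down_steps_def nth_append less_Suc_eq)
  moreover have "length w \<notin> down_steps w" by (simp add: down_steps_def)
  moreover have "down_height (w @ [Down]) (length w) = height w"
    by (simp add: down_height_def)
  ultimately show ?thesis
    by (simp add: prod_down_steps_snoc down_weight_def[of "w @ [Down]"])
qed

lemma down_weight_replicate_Down:
  assumes "height w = int h" and "k \<le> h"
  shows "down_weight (w @ replicate k Down) * fact (h - k) = down_weight w * fact h"
  using assms(2)
proof (induction k)
  case 0
  show ?case by simp
next
  case (Suc k)
  have "nat (height (w @ replicate k Down)) = h - k"
    using assms(1) by simp
  moreover have "(fact (h - k) :: nat) = (h - k) * fact (h - Suc k)"
    using Suc.prems fact_reduce[of "h - k", where 'a = nat] by simp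
  moreover have "w @ replicate (Suc k) Down = (w @ replicate k Down) @ [Down]"
    by (simp add: replicate_append_same[symmetric])
  ultimately have "down_weight (w @ replicate (Suc k) Down) * fact (h - Suc k)
      = down_weight (w @ replicate k Down) * fact (h - k)"
    by (simp only: down_weight_snoc_Down) simp
  then show ?case using Suc by simp
qed

text \<open>
  Multiplicative form of level crossing: an up step from height \<open>h\<close> multiplies both sides by
  \<open>h + 1\<close>, and a down step from height \<open>h\<close> moves the factor \<open>h\<close> from the factorial into the
  weight. The factorial thus accounts for the levels that are still to be crossed
  downwards; it is \<open>1\<close> for a path that has returned to the axis.
\<close>

lemma down_weight_path_of:
  assumes "\<And>i. i < length ks \<Longrightarrow> sum_list (take (Suc i) ks) \<le> i"
  shows "down_weight (path_of ks) * fact (length ks - sum_list ks)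
    = (\<Prod>i<length ks. Suc i - sum_list (take (Suc i) ks))"
  using assms
proof (induction ks rule: rev_induct)
  case Nil
  show ?case by (simp add: down_weight_def down_steps_def)
next
  case (snoc k ks)
  have "sum_list (take (Suc i) ks) \<le> i" if "i < length ks" for i
    using snoc.prems[of i] that by simp
  note IH = snoc.IH[OF this]
  have le: "sum_list ks + k \<le> length ks"
    using snoc.prems[of "length ks"] by simp
  define h where "h = length ks - sum_list ks"
  have h: "height (path_of ks) = int h" "k \<le> h"
    using le by (simp_all add: h_def)
  have "down_weight (path_of (ks @ [k])) = down_weight (path_of ks @ replicate k Down)"
    using down_weight_snoc_Up[of "path_of ks @ replicate k Down"] by simp
  moreover have "length (ks @ [k]) - sum_list (ks @ [k]) = Suc (h - k)"
    using le by (simp add: h_def)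
  ultimately have "down_weight (path_of (ks @ [k])) * fact (length (ks @ [k]) - sum_list (ks @ [k]))
      = Suc (h - k) * (down_weight (path_of ks @ replicate k Down) * fact (h - k))"
    by (simp only: fact_Suc) (simp add: algebra_simps)
  also have "\<dots> = Suc (h - k) * (\<Prod>i<length ks. Suc i - sum_list (take (Suc i) ks))"
    by (simp only: down_weight_replicate_Down[OF h]) (simp add: IH[folded h_def])
  also have "\<dots> = (\<Prod>i<length (ks @ [k]). Suc i - sum_list (take (Suc i) (ks @ [k])))"
    using le by (simp add: h_def Suc_diff_le mult.commute)
  finally show ?case .
qed

section \<open>The parking process, one car at a time\<close>

fun descents :: "nat \<Rightarrow> (nat \<times> nat) list \<Rightarrow> nat list" where
  "descents s [] = []"
| "descents s ((a, t) # cars) = (if t = a then 0 # descents s cars else (s - t) # descents t cars)"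

fun front :: "nat \<Rightarrow> (nat \<times> nat) list \<Rightarrow> nat" where
  "front s [] = s"
| "front s ((a, t) # cars) = (if t = a then front s cars else front t cars)"

lemma phi_steps_eq_path_of: "phi_steps s cars = path_of (descents s cars)"
  by (induction s cars rule: descents.induct) auto

lemma descents_snoc:
  "descents s (cars @ [(a, t)]) = descents s cars @ [if t = a then 0 else front s cars - t]"
  by (induction s cars rule: descents.induct) auto

lemma front_snoc: "front s (cars @ [(a, t)]) = (if t = a then front s cars else t)"
  by (induction s cars rule: descents.induct) auto

lemma length_descents [simp]: "length (descents s cars) = length cars"
  by (induction s cars rule: descents.induct) auto

lemma length_park [simp]: "length (park n occ as) = length as"
  by (induction n occ as rule: park.induct) (auto split: option.splits)

definition taken :: "nat \<Rightarrow> nat list \<Rightarrow> nat set" where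
  "taken n as = {t. Some t \<in> set (park n {} as)}"

definition all_park :: "nat \<Rightarrow> nat list \<Rightarrow> bool" where
  "all_park n as \<longleftrightarrow> set as \<subseteq> {1..n} \<and> None \<notin> set (park n {} as)"

definition cars_of :: "nat \<Rightarrow> nat list \<Rightarrow> (nat \<times> nat) list" where
  "cars_of n as = zip as (map the (park n {} as))"

lemma park_snoc:
  "park n occ (as @ [a])
    = park n occ as @ [choose_spot n (occ \<union> {t. Some t \<in> set (park n occ as)}) a]"
proof (induction n occ as rule: park.induct)
  case (1 n occ)
  show ?case by (simp split: option.splits)
next
  case (2 n occ b as)
  show ?case
  proof (cases "choose_spot n occ b")
    case None
    then show ?thesis using 2 by simp
  next
    case (Some t)
    have "insert t occ \<union> {u. Some u \<in> set (park n (insert t occ) as)}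
        = occ \<union> {u. u = t \<or> Some u \<in> set (park n (insert t occ) as)}"
      by auto
    then show ?thesis using 2(2)[OF Some] Some by simp
  qed
qed

lemma park_snoc_taken: "park n {} (as @ [a]) = park n {} as @ [choose_spot n (taken n as) a]"
  by (simp add: park_snoc taken_def)

lemma all_park_snoc:
  "all_park n (as @ [a])
    \<longleftrightarrow> all_park n as \<and> a \<in> {1..n} \<and> (\<exists>t. choose_spot n (taken n as) a = Some t)"
  by (cases "choose_spot n (taken n as) a") (auto simp: all_park_def park_snoc_taken)

lemma taken_snoc:
  "choose_spot n (taken n as) a = Some t \<Longrightarrow> taken n (as @ [a]) = insert t (taken n as)"
  by (auto simp: taken_def[of n "as @ [a]"] park_snoc_taken) (auto simp: taken_def)

lemma cars_of_snoc:
  "choose_spot n (taken n as) a = Some t \<Longrightarrow> cars_of n (as @ [a]) = cars_of n as @ [(a, t)]"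
  by (simp add: cars_of_def park_snoc_taken)

lemma choose_spot_eq_Some_iff:
  "choose_spot n occ a = Some t
    \<longleftrightarrow> a \<notin> occ \<and> t = a \<or> a \<in> occ \<and> a < t \<and> t \<le> n \<and> t \<notin> occ \<and> {t<..n} \<subseteq> occ"
proof (cases "a \<in> occ")
  case False
  then show ?thesis by (auto simp: choose_spot_def)
next
  case True
  have fin: "finite (free_above n occ a)" by (simp add: free_above_def)
  have "choose_spot n occ a = Some t
      \<longleftrightarrow> t \<in> free_above n occ a \<and> (\<forall>u \<in> free_above n occ a. u \<le> t)"
    using True fin Max_eq_iff[OF fin, of t] by (auto simp: choose_spot_def)
  also have "\<dots> \<longleftrightarrow> a < t \<and> t \<le> n \<and> t \<notin> occ \<and> {t<..n} \<subseteq> occ"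
    unfolding free_above_def subset_iff mem_Collect_eq Ball_def greaterThanAtMost_iff
    by (meson less_trans not_le)
  finally show ?thesis using True by simp
qed

text \<open>
  That the front and the descents add up to \<open>n + 1\<close> says that no subtraction in the
  descents is truncated: a new unlucky car finds all spots from the front on taken, so it parks
  strictly to the left of the front.
\<close>

lemma all_park_invariant:
  assumes "all_park n as"
  defines "s \<equiv> front (Suc n) (cars_of n as)"
  shows "taken n as \<subseteq> {1..n}" and "card (taken n as) = length as"
    and "1 \<le> s" and "{s..n} \<subseteq> taken n as"
    and "s + sum_list (descents (Suc n) (cars_of n as)) = n + 1"
proof -
  have "taken n as \<subseteq> {1..n} \<and> card (taken n as) = length as \<and> 1 \<le> s \<and> {s..n} \<subseteq> taken n as \<and>
      s + sum_list (descents (Suc n) (cars_of n as)) = n + 1"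
    using assms(1) unfolding s_def
  proof (induction as rule: rev_induct)
    case Nil
    show ?case by (simp add: taken_def cars_of_def)
  next
    case (snoc a as)
    define O' where "O' = taken n as"
    define s' where "s' = front (Suc n) (cars_of n as)"
    from snoc.prems obtain t where ap: "all_park n as" and a: "a \<in> {1..n}"
      and t: "choose_spot n (taken n as) a = Some t"
      by (auto simp: all_park_snoc)
    have IH: "O' \<subseteq> {1..n}" "card O' = length as" "1 \<le> s'" "{s'..n} \<subseteq> O'"
      "s' + sum_list (descents (Suc n) (cars_of n as)) = n + 1"
      using snoc.IH[OF ap] by (simp_all add: O'_def s'_def)
    have fin: "finite O'" using IH(1) finite_subset by blast
    note step = taken_snoc[OF t, folded O'_def] cars_of_snoc[OF t]
    from t consider (lucky) "t = a" "a \<notin> O'"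
      | (unlucky) "a < t" "t \<le> n" "t \<notin> O'" "{t<..n} \<subseteq> O'"
      by (auto simp: choose_spot_eq_Some_iff O'_def)
    then show ?case
    proof cases
      case lucky
      then show ?thesis
        using IH a fin by (auto simp: step descents_snoc front_snoc simp flip: s'_def)
    next
      case unlucky
      have "t < s'"
        using unlucky IH(4) by (meson atLeastAtMost_iff not_le subsetD)
      moreover have "{t..n} \<subseteq> insert t O'"
        using unlucky(2,4) by (simp add: atLeastAtMost_insertL[symmetric] atLeastSucAtMost_greaterThanAtMost subset_insertI2)
      ultimately show ?thesis
        using unlucky IH a fin by (auto simp: step descents_snoc front_snoc simp flip: s'_def)
    qed
  qed
  then show "taken n as \<subseteq> {1..n}" "card (taken n as) = length as"
    "1 \<le> s" "{s..n} \<subseteq> taken n as"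
    "s + sum_list (descents (Suc n) (cars_of n as)) = n + 1"
    by auto
qed

section \<open>Counting by removing the last car\<close>

definition fiber :: "nat \<Rightarrow> nat list \<Rightarrow> nat set \<Rightarrow> nat list set" where
  "fiber n ks occ = {as. all_park n as \<and> taken n as = occ \<and> descents (Suc n) (cars_of n as) = ks}"

lemma finite_fiber: "finite (fiber n ks occ)"
proof (rule finite_subset)
  show "fiber n ks occ \<subseteq> {as. set as \<subseteq> {1..n} \<and> length as = length ks}"
    by (auto simp: fiber_def all_park_def cars_of_def)
  show "finite {as. set as \<subseteq> {1..n} \<and> length as = length ks}"
    by (rule finite_lists_length_eq) simp
qed

text \<open>
  The last car has preference \<open>a\<close>. For \<open>k = 0\<close> it is lucky and frees \<open>a\<close>; otherwise it is
  unlucky and frees the front \<open>s\<close>. In both cases \<open>a\<close> is an arbitrary taken spot below \<open>s\<close>, and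
  the spots from the preceding front on stay taken, so that no further condition on \<open>a\<close>
  arises from the earlier cars.
\<close>

lemma fiber_snoc:
  assumes occ: "occ \<subseteq> {1..n}" and sum: "sum_list ks + k \<le> n"
    and s_def: "s = n + 1 - (sum_list ks + k)" and taken: "{s..n} \<subseteq> occ"
  shows "fiber n (ks @ [k]) occ
    = (\<lambda>(a, as). as @ [a]) `
        (SIGMA a : occ \<inter> {..<s}. fiber n ks (occ - {if k = 0 then a else s}))"
    (is "?L = ?R")
proof (intro equalityI subsetI)
  fix bs
  assume bs: "bs \<in> ?L"
  then have "length bs = Suc (length ks)"
    by (auto simp: fiber_def cars_of_def dest: arg_cong[of _ _ length])
  then obtain as a where eq: "bs = as @ [a]" by (metis length_Suc_conv_rev)
  with bs obtain t where ap: "all_park n as" and a: "a \<in> {1..n}"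
    and t: "choose_spot n (taken n as) a = Some t"
    by (auto simp: fiber_def all_park_snoc)
  define f where "f = front (Suc n) (cars_of n as)"
  note inv = all_park_invariant[OF ap, folded f_def]
  have occ_eq: "occ = insert t (taken n as)"
    using bs taken_snoc[OF t] by (simp add: eq fiber_def)
  have ks: "descents (Suc n) (cars_of n as) = ks" and k: "k = (if t = a then 0 else f - t)"
    using bs by (auto simp: eq fiber_def cars_of_snoc[OF t] descents_snoc f_def)
  from t consider (lucky) "t = a" "a \<notin> taken n as"
    | (unlucky) "a \<in> taken n as" "a < t" "t \<le> n" "t \<notin> taken n as"
    by (auto simp: choose_spot_eq_Some_iff)
  then have "a \<in> occ \<inter> {..<s} \<and> taken n as = occ - {if k = 0 then a else s}"
  proof cases
    case lucky
    then have "k = 0" "s = f" using inv(5) ks k by (auto simp: s_def)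
    moreover have "a < f" using lucky a inv(4) by (meson atLeastAtMost_iff not_le subsetD)
    ultimately show ?thesis using lucky occ_eq by auto
  next
    case unlucky
    then have "t < f" using inv(4) by (meson atLeastAtMost_iff not_le subsetD)
    then have "k \<noteq> 0" "s = t" using unlucky inv(5) ks k by (auto simp: s_def)
    then show ?thesis using unlucky occ_eq by auto
  qed
  then have "(a, as) \<in> (SIGMA a : occ \<inter> {..<s}. fiber n ks (occ - {if k = 0 then a else s}))"
    using ap ks by (auto simp: fiber_def)
  then show "bs \<in> ?R" using eq by force
next
  fix bs
  assume "bs \<in> ?R"
  then obtain a as where eq: "bs = as @ [a]" and a: "a \<in> occ" "a < s"
    and as: "as \<in> fiber n ks (occ - {if k = 0 then a else s})"
    by auto
  define t where "t = (if k = 0 then a else s)"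
  have ap: "all_park n as" and tk: "taken n as = occ - {t}"
    and ks: "descents (Suc n) (cars_of n as) = ks"
    using as by (auto simp: fiber_def t_def)
  have "front (Suc n) (cars_of n as) + sum_list ks = n + 1"
    using all_park_invariant(5)[OF ap] ks by simp
  then have front: "front (Suc n) (cars_of n as) = s + k"
    using sum by (simp add: s_def)
  have "s \<in> occ" "s \<le> n" if "k \<noteq> 0"
    using that sum taken by (auto simp: s_def)
  then have t: "choose_spot n (taken n as) a = Some t" and t_occ: "t \<in> occ"
    using a taken by (auto simp: choose_spot_eq_Some_iff tk t_def)
  show "bs \<in> ?L"
    using ap a occ t_occ
    by (auto simp: eq fiber_def all_park_snoc t[unfolded tk] taken_snoc[OF t] cars_of_snoc[OF t] tk
        ks descents_snoc front) (auto simp: t_def split: if_splits)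
qed

text \<open>
  The hypotheses on \<open>occ\<close> are exactly the invariants of the process. The right-hand side does not
  depend on \<open>occ\<close>, which makes the induction multiply: whichever spot the last car frees, the
  remaining cars have the same number of possibilities.
\<close>

lemma card_fiber:
  assumes "occ \<subseteq> {1..n}" and "card occ = length ks" and "sum_list ks \<le> n"
    and "{n + 1 - sum_list ks..n} \<subseteq> occ"
  shows "card (fiber n ks occ) = (\<Prod>i<length ks. Suc i - sum_list (take (Suc i) ks))"
  using assms
proof (induction ks arbitrary: occ rule: rev_induct)
  case Nil
  then have "occ = {}" using finite_subset by fastforce
  then have "fiber n [] occ = {[]}"
    by (auto simp: fiber_def all_park_def taken_def cars_of_def
        simp flip: length_0_conv[of "descents _ _"])
  then show ?case by simp
next
  case (snoc k ks)
  define s where "s = n + 1 - (sum_list ks + k)"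
  define free where "free a = (if k = 0 then a else s)" for a
  have sum: "sum_list ks + k \<le> n" and taken: "{s..n} \<subseteq> occ"
    using snoc.prems by (simp_all add: s_def)
  have fin: "finite occ" using snoc.prems(1) finite_subset by blast
  have fiber: "card (fiber n ks (occ - {free a})) = (\<Prod>i<length ks. Suc i - sum_list (take (Suc i) ks))"
    if a: "a \<in> occ \<inter> {..<s}" for a
  proof (rule snoc.IH)
    have "free a \<in> occ"
      using a sum taken by (auto simp: free_def s_def)
    then show "card (occ - {free a}) = length ks"
      using snoc.prems(2) fin by simp
    \<comment> \<open>the spot that becomes free lies before the preceding front\<close>
    have "free a < n + 1 - sum_list ks"
      using a sum by (auto simp: free_def s_def)
    then show "{n + 1 - sum_list ks..n} \<subseteq> occ - {free a}"
      using taken by (fastforce simp: s_def subset_iff)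
  qed (use snoc.prems sum in auto)
  have "card (fiber n (ks @ [k]) occ)
      = card (SIGMA a : occ \<inter> {..<s}. fiber n ks (occ - {free a}))"
    unfolding fiber_snoc[OF snoc.prems(1) sum s_def taken] free_def
    by (rule card_image) (auto simp: inj_on_def)
  also have "\<dots> = card (occ \<inter> {..<s}) * (\<Prod>i<length ks. Suc i - sum_list (take (Suc i) ks))"
    using fiber by (simp add: card_SigmaI finite_fiber fin)
  also have "card (occ \<inter> {..<s}) = Suc (length ks) - (sum_list ks + k)"
  proof -
    have "occ \<inter> {..<s} = occ - {s..n}" using snoc.prems(1) by auto
    then show ?thesis
      using snoc.prems(2) taken sum by (simp add: card_Diff_subset s_def)
  qed
  finally show ?case by (simp add: mult.commute)
qed

section \<open>The fibers of the map to Dyck paths\<close>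

lemma card_height_labelings:
  assumes "D \<in> dyck_paths n"
  shows "card {P \<in> height_labeled_dyck_paths n. fst P = D} = down_weight D"
proof -
  define L where "L = (\<Pi>\<^sub>E k \<in> down_steps D. {m. 1 \<le> m \<and> int m \<le> down_height D k})"
  have "{P \<in> height_labeled_dyck_paths n. fst P = D} = Pair D ` L"
    using assms by (auto simp: height_labeled_dyck_paths_def L_def)
  then have "card {P \<in> height_labeled_dyck_paths n. fst P = D} = card L"
    by (simp add: card_image inj_on_def)
  also have "\<dots> = (\<Prod>k \<in> down_steps D. card {m. 1 \<le> m \<and> int m \<le> down_height D k})"
    by (simp add: L_def card_PiE)
  also have "\<dots> = down_weight D"
  proof -
    have "{m. 1 \<le> m \<and> int m \<le> z} = {1..nat z}" for z by auto
    then show ?thesis by (simp add: down_weight_def)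
  qed
  finally show ?thesis .
qed

lemma phi_eq_path_of:
  "phi n as = path_of (descents (Suc n) (cars_of n as))
    @ replicate (length as - sum_list (descents (Suc n) (cars_of n as))) Down"
  by (simp add: phi_def Let_def phi_steps_eq_path_of cars_of_def nat_diff_distrib' flip: of_nat_diff)

lemma phi_fiber_eq_fiber:
  assumes "D = path_of ks @ replicate (n - sum_list ks) Down"
  shows "{as \<in> FPF n. phi n as = D} = fiber n ks {1..n}"
proof (intro equalityI subsetI)
  fix as
  assume "as \<in> {as \<in> FPF n. phi n as = D}"
  then have ap: "all_park n as" and len: "length as = n" and phi: "phi n as = D"
    by (auto simp: FPF_def all_park_def)
  have "taken n as = {1..n}"
    using all_park_invariant(1,2)[OF ap] len by (intro card_subset_eq) auto
  moreover have "descents (Suc n) (cars_of n as) = ks"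
    using phi unfolding phi_eq_path_of assms by (rule path_of_append_inject)
  ultimately show "as \<in> fiber n ks {1..n}"
    using ap by (simp add: fiber_def)
next
  fix as
  assume as: "as \<in> fiber n ks {1..n}"
  then have ap: "all_park n as" by (simp add: fiber_def)
  have len: "length as = n"
    using all_park_invariant(2)[OF ap] as by (simp add: fiber_def)
  then have "phi n as = D"
    using as unfolding phi_eq_path_of assms by (simp add: fiber_def)
  then show "as \<in> {as \<in> FPF n. phi n as = D}"
    using ap len by (simp add: FPF_def all_park_def)
qed

theorem proposition2p17:
  fixes n :: nat and D :: "step list"
  assumes "n \<ge> 1" and "D \<in> dyck_paths n"
  shows "card {as \<in> FPF n. phi n as = D} =
         card {P \<in> height_labeled_dyck_paths n. fst P = D}"
proof -
  obtain ks m where D: "D = path_of ks @ replicate m Down"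
    using ex_path_of by blast
  have len: "length ks = n" and sum: "sum_list ks + m = n"
    and nonneg: "\<And>u v. D = u @ v \<Longrightarrow> height u \<ge> 0"
  proof -
    show "length ks = n" "sum_list ks + m = n"
      using assms(2) by (simp_all add: dyck_paths_def D)
    fix u v
    assume "D = u @ v"
    then show "height u \<ge> 0"
      using assms(2) by (auto simp: dyck_paths_def dest!: spec[of _ "length u"])
  qed
  have m: "n - sum_list ks = m" using sum by simp
  \<comment> \<open>this is the height at the foot of an up step, which is not negative\<close>
  have le: "sum_list (take (Suc i) ks) \<le> i" if i: "i < length ks" for i
  proof -
    have "path_of ks = path_of (take i ks @ ks ! i # drop (Suc i) ks)"
      using id_take_nth_drop[OF i] by simp
    then have "D = (path_of (take i ks) @ replicate (ks ! i) Down)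
        @ (Up # path_of (drop (Suc i) ks) @ replicate m Down)"
      by (simp add: D)
    from nonneg[OF this] show ?thesis
      using i by (simp add: take_Suc_conv_app_nth)
  qed
  have "card {as \<in> FPF n. phi n as = D} = card (fiber n ks {1..n})"
    by (subst phi_fiber_eq_fiber) (simp_all add: D m)
  also have "\<dots> = (\<Prod>i<length ks. Suc i - sum_list (take (Suc i) ks))"
    using len sum by (intro card_fiber) auto
  also have "\<dots> = down_weight (path_of ks) * fact (length ks - sum_list ks)"
    by (rule down_weight_path_of[symmetric]) (rule le)
  also have "\<dots> = down_weight D"
  proof -
    have "height (path_of ks) = int m" using len sum by simp
    from down_weight_replicate_Down[OF this order_refl] show ?thesis
      by (simp add: D len m)
  qed
  also have "\<dots> = card {P \<in> height_labeled_dyck_paths n. fst P = D}"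
    using card_height_labelings[OF assms(2)] by simp
  finally show ?thesis .
qed

end
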